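(* For all $n\geq 0$ we have $$Q_{n+1}(Z)=W_2(Z)^{n/2}\cdot U_n\left(\frac{W_1(Z)}{2W_2(Z)^{1/2}}\right),$$ $$R_n(Z)=W_2(Z)^{n/2}\cdot T_n\left(\frac{W_1(Z)}{2W_2(Z)^{1/2}}\right)+\frac{w+x+y-(wxy+wz+xz)}{2}\,Q_n(Z).$$
   Context: Let $Z=(w,x,y,z)$ be a quadruple of variables. The polynomials $S(n;Z)$, $n\ge 0$, are defined by the generating function $$\sum_{n=0}^{\infty}S(n;Z)q^n = \prod_{j=0}^{\infty}\left(1+wq^{3^j}\right)\left(1+xq^{3^j}\right)\left(1+yq^{3^j}+zq^{2\cdot 3^j}\right),$$ with the convention $S(-1;Z)=0$. For $n\ge 0$ define $$Q_n(Z):=S(\tfrac{3^n-3}{2};Z),\qquad R_n(Z):=S(\tfrac{3^n-1}{2};Z),$$ so that $Q_0(Z)=0$. Further, $$W_1(Z):=wxy+wz+xz+w+x+y,$$ $$W_2(Z):=w^2xy+w^2z+wx^2y+wxy^2+wxz+wyz+x^2z+xyz.$$ $T_n(v)$ and $U_n(v)$ are the Chebyshev polynomials of the first and second kind, defined by $$\sum_{n=0}^{\infty}T_n(v)t^n = \frac{1-vt}{1-2vt+t^2},\qquad \sum_{n=0}^{\infty}U_n(v)t^n = \frac{1}{1-2vt+t^2}.$$ $W_2(Z)^{1/2}$ denotes a fixed square root of the nonzero polynomial $W_2(Z)$ (in an extension of the field of rational functions in $w,x,y,z$; or, for numerical values of the variables, a fixed square root where $W_2(Z)\neq 0$), and $W_2(Z)^{n/2}:=(W_2(Z)^{1/2})^n$.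 *)

theory Defs
  imports "HOL-Analysis.Analysis"
begin

text \<open>
  The quadruple of variables \<open>Z = (w, x, y, z)\<close> is rendered by four elements of an arbitrary
  commutative ring, and a polynomial in \<open>Z\<close> by the corresponding element of that ring. Taking
  for the ring a polynomial ring (or an extension of its field of fractions) and for \<open>w, x, y, z\<close>
  its indeterminates gives the formal objects; lemma \<open>S_hom\<close> below shows that evaluating these
  under any ring homomorphism agrees with evaluating the definition directly.
\<close>

definition S_factor :: "'a::comm_ring_1 \<Rightarrow> 'a \<Rightarrow> 'a \<Rightarrow> 'a \<Rightarrow> nat \<Rightarrow> 'a fps" where
  "S_factor w x y z j =
     (1 + fps_const w * fps_X ^ (3 ^ j)) * (1 + fps_const x * fps_X ^ (3 ^ j)) *
     (1 + fps_const y * fps_X ^ (3 ^ j) + fps_const z * fps_X ^ (2 * 3 ^ j))"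

text \<open>The infinite product is taken in the usual topology of formal power series.\<close>

definition S_gf :: "'a::comm_ring_1 \<Rightarrow> 'a \<Rightarrow> 'a \<Rightarrow> 'a \<Rightarrow> 'a fps" where
  "S_gf w x y z = (\<Prod>j. S_factor w x y z j)"

text \<open>The index is an integer because of the convention \<open>S(-1; Z) = 0\<close>.\<close>

definition S :: "int \<Rightarrow> 'a::comm_ring_1 \<Rightarrow> 'a \<Rightarrow> 'a \<Rightarrow> 'a \<Rightarrow> 'a" where
  "S m w x y z = (if m < 0 then 0 else fps_nth (S_gf w x y z) (nat m))"

definition Q :: "nat \<Rightarrow> 'a::comm_ring_1 \<Rightarrow> 'a \<Rightarrow> 'a \<Rightarrow> 'a \<Rightarrow> 'a" where
  "Q n w x y z = S ((3 ^ n - 3) div 2) w x y z"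

definition R :: "nat \<Rightarrow> 'a::comm_ring_1 \<Rightarrow> 'a \<Rightarrow> 'a \<Rightarrow> 'a \<Rightarrow> 'a" where
  "R n w x y z = S ((3 ^ n - 1) div 2) w x y z"

definition W1 :: "'a::comm_ring_1 \<Rightarrow> 'a \<Rightarrow> 'a \<Rightarrow> 'a \<Rightarrow> 'a" where
  "W1 w x y z = w * x * y + w * z + x * z + w + x + y"

definition W2 :: "'a::comm_ring_1 \<Rightarrow> 'a \<Rightarrow> 'a \<Rightarrow> 'a \<Rightarrow> 'a" where
  "W2 w x y z =
     w\<^sup>2 * x * y + w\<^sup>2 * z + w * x\<^sup>2 * y + w * x * y\<^sup>2 + w * x * z + w * y * z + x\<^sup>2 * z + x * y * z"

definition cheb_T :: "nat \<Rightarrow> 'a::field \<Rightarrow> 'a" where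
  "cheb_T n v =
     fps_nth ((1 - fps_const v * fps_X) / (1 - fps_const (2 * v) * fps_X + fps_X\<^sup>2)) n"

definition cheb_U :: "nat \<Rightarrow> 'a::field \<Rightarrow> 'a" where
  "cheb_U n v = fps_nth (1 / (1 - fps_const (2 * v) * fps_X + fps_X\<^sup>2)) n"

text \<open>The infinite product converges, and its coefficients are those of finite partial products.\<close>

lemma S_factor_nth_0: "fps_nth (S_factor w x y z j) 0 = 1"
  by (simp add: S_factor_def)

lemma S_factor_nth_less:
  fixes w x y z :: "'a::comm_ring_1"
  assumes "0 < k" "k < 3 ^ j"
  shows "fps_nth (S_factor w x y z j) k = 0"
proof -
  have eq: "S_factor w x y z j = 1 + fps_X ^ (3 ^ j) *
     ((fps_const w + fps_const x + fps_const w * fps_const x * fps_X ^ (3 ^ j)) *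
      (1 + fps_const y * fps_X ^ (3 ^ j) + fps_const z * fps_X ^ (2 * 3 ^ j)) +
      fps_const y + fps_const z * fps_X ^ (3 ^ j))"
  proof -
    have "(1 + a * X) * (1 + b * X) * (1 + c * X + d * (X * X)) =
        1 + X * ((a + b + a * b * X) * (1 + c * X + d * (X * X)) + c + d * X)"
      for a b c d X :: "'a fps"
      by (simp add: algebra_simps)
    thus ?thesis
      by (simp only: S_factor_def mult_2 power_add)
  qed
  show ?thesis
    unfolding eq using assms by (simp add: fps_X_power_mult_nth)
qed

lemma S_partial_nth:
  assumes "k \<le> m"
  shows "fps_nth (\<Prod>j\<le>m. S_factor w x y z j) k = fps_nth (\<Prod>j\<le>k. S_factor w x y z j) k"
  using assms
proof (induction m rule: dec_induct)
  case (step m)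
  let ?P = "\<Prod>j\<le>m. S_factor w x y z j" and ?f = "S_factor w x y z (Suc m)"
  have lt: "k < 3 ^ Suc m"
    using step.hyps less_exp[of "Suc m"] power_mono[of "2::nat" 3 "Suc m"] by linarith
  have "fps_nth (?P * ?f) k = (\<Sum>i=0..k. fps_nth ?P i * fps_nth ?f (k - i))"
    by (simp add: fps_mult_nth)
  also have "\<dots> = (\<Sum>i=0..k. if i = k then fps_nth ?P k else 0)"
    using lt by (intro sum.cong refl) (auto simp: S_factor_nth_0 S_factor_nth_less)
  also have "\<dots> = fps_nth ?P k"
    by simp
  finally show ?case
    using step.IH by simp
qed auto

lemma S_factor_has_prod:
  fixes w x y z :: "'a::comm_ring_1"
  shows "S_factor w x y z has_prod
           Abs_fps (\<lambda>n. fps_nth (\<Prod>j\<le>n. S_factor w x y z j) n)" (is "_ has_prod ?L")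
proof -
  have "(\<lambda>n. \<Prod>j\<le>n. S_factor w x y z j) \<longlonglongrightarrow> ?L"
  proof (rule tendsto_fpsI)
    fix k
    show "eventually (\<lambda>n. fps_nth (\<Prod>j\<le>n. S_factor w x y z j) k = fps_nth ?L k) sequentially"
      using eventually_ge_at_top[of k]
      by eventually_elim (subst fps_nth_Abs_fps, rule S_partial_nth)
  qed
  moreover have "fps_nth ?L 0 = 1"
    by (simp add: S_factor_nth_0)
  hence "?L \<noteq> 0"
    by (metis fps_zero_nth zero_neq_one)
  ultimately show ?thesis
    by (simp add: has_prod_def raw_has_prod_def)
qed

lemma S_gf_eq: "S_gf w x y z = Abs_fps (\<lambda>n. fps_nth (\<Prod>j\<le>n. S_factor w x y z j) n)"
  (is "_ = ?L")
proof -
  have "p = ?L" if "S_factor w x y z has_prod p" for p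
  proof -
    have "S_factor w x y z i \<noteq> 0" for i
      by (metis S_factor_nth_0 fps_zero_nth zero_neq_one)
    with that S_factor_has_prod[of w x y z] show ?thesis
      by (auto simp: has_prod_def raw_has_prod_def intro: LIMSEQ_unique)
  qed
  with S_factor_has_prod[of w x y z] show ?thesis
    unfolding S_gf_def prodinf_def by (intro the_equality)
qed

lemma S_gf_has_prod: "S_factor w x y z has_prod S_gf w x y z"
  unfolding S_gf_eq by (rule S_factor_has_prod)

lemma S_eq: "S (int n) w x y z = fps_nth (\<Prod>j\<le>n. S_factor w x y z j) n"
  by (simp add: S_def S_gf_eq)

lemma S_hom:
  fixes h :: "'a::comm_ring_1 \<Rightarrow> 'b::comm_ring_1"
  assumes add: "\<And>a b. h (a + b) = h a + h b"
    and mult: "\<And>a b. h (a * b) = h a * h b" and one: "h 1 = 1"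
  shows "S m (h w) (h x) (h y) (h z) = h (S m w x y z)"
proof -
  have zero: "h 0 = 0"
    using add[of 0 0] by simp
  have hsum: "h (sum g A) = (\<Sum>i\<in>A. h (g i))" for g :: "nat \<Rightarrow> 'a" and A
    by (induction A rule: infinite_finite_induct) (auto simp: zero add)
  define H where "H = (\<lambda>F. Abs_fps (\<lambda>n. h (fps_nth F n)))"
  have Hmult: "H (F * G) = H F * H G" for F G
    by (simp add: H_def fps_eq_iff fps_mult_nth hsum mult)
  have Hadd: "H (F + G) = H F + H G" for F G
    by (simp add: H_def fps_eq_iff add)
  have Hone: "H 1 = 1"
    by (simp add: H_def fps_eq_iff zero one)
  have Hconst: "H (fps_const a) = fps_const (h a)" for a
    by (simp add: H_def fps_eq_iff zero)
  have HX: "H (fps_X ^ n) = fps_X ^ n" for n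
    by (simp add: H_def fps_eq_iff fps_X_power_iff zero one)
  have Hfac: "H (S_factor w x y z j) = S_factor (h w) (h x) (h y) (h z) j" for j
    by (simp add: S_factor_def Hmult Hadd Hone Hconst HX)
  have "H (\<Prod>j\<le>n. S_factor w x y z j) = (\<Prod>j\<le>n. S_factor (h w) (h x) (h y) (h z) j)" for n
    by (induction n) (simp_all add: Hfac Hmult)
  hence "fps_nth (\<Prod>j\<le>n. S_factor (h w) (h x) (h y) (h z) j) n =
      h (fps_nth (\<Prod>j\<le>n. S_factor w x y z j) n)" for n
    by (metis H_def fps_nth_Abs_fps)
  thus ?thesis
    by (simp add: S_def S_gf_eq zero)
qed

end

theory Submission
  imports Defs "HOL-Computational_Algebra.Formal_Laurent_Series"
begin

text \<open>
  The generating function \<open>F(q)\<close> of the \<open>S(n; Z)\<close> satisfies the Mahler equation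
  \<open>F(q) = f(q) F(q\<^sup>3)\<close>, where \<open>f\<close> is the factor of index \<open>j = 0\<close>, a polynomial of degree four
  with coefficients \<open>1, a\<^sub>1, a\<^sub>2, a\<^sub>3, a\<^sub>4\<close>; here \<open>a\<^sub>1 = w + x + y\<close>, \<open>a\<^sub>3 = wxy + wz + xz\<close> and
  \<open>a\<^sub>4 = wxz\<close>. Comparing coefficients in the residue classes \<open>0\<close> and
  \<open>1\<close> modulo \<open>3\<close> expresses \<open>S(3m)\<close> and \<open>S(3m + 1)\<close> through \<open>S(m)\<close> and \<open>S(m - 1)\<close>. The indices
  \<open>r\<^sub>n = (3\<^sup>n - 1) / 2\<close> and \<open>q\<^sub>n = r\<^sub>n - 1\<close> satisfy \<open>r\<^sub>n\<^sub>+\<^sub>1 = 3 r\<^sub>n + 1\<close> and \<open>q\<^sub>n\<^sub>+\<^sub>1 = 3 r\<^sub>n\<close>, so the pair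
  \<open>(Q\<^sub>n, R\<^sub>n)\<close> evolves linearly (\<open>Q_Suc\<close>, \<open>R_Suc\<close>):

  \<open>Q\<^sub>n\<^sub>+\<^sub>1 = R\<^sub>n + a\<^sub>3 Q\<^sub>n\<close> and \<open>R\<^sub>n\<^sub>+\<^sub>1 = a\<^sub>1 R\<^sub>n + a\<^sub>4 Q\<^sub>n\<close>.

  The matrix of this system has trace \<open>a\<^sub>1 + a\<^sub>3 = W\<^sub>1\<close> and determinant \<open>a\<^sub>1 a\<^sub>3 - a\<^sub>4 = W\<^sub>2\<close>. By
  Cayley--Hamilton, \<open>Q\<^sub>n\<^sub>+\<^sub>2 = W\<^sub>1 Q\<^sub>n\<^sub>+\<^sub>1 - W\<^sub>2 Q\<^sub>n\<close>, which is the recurrence of the rescaled Chebyshev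
  polynomials \<open>s\<^sup>n U\<^sub>n(W\<^sub>1 / (2 s))\<close> for \<open>s\<^sup>2 = W\<^sub>2\<close>. The formula for \<open>R\<^sub>n\<close> then follows from
  \<open>R\<^sub>n = Q\<^sub>n\<^sub>+\<^sub>1 - a\<^sub>3 Q\<^sub>n\<close> and \<open>T\<^sub>n = U\<^sub>n - v U\<^sub>n\<^sub>-\<^sub>1\<close>.
\<close>

section \<open>The Mahler equation of the generating function\<close>

lemma S_factor_compose_cube:
  fixes w x y z :: "'a::idom"
  shows "S_factor w x y z j oo fps_X ^ 3 = S_factor w x y z (Suc j)"
proof -
  have X: "fps_X ^ k oo fps_X ^ 3 = (fps_X ^ (3 * k) :: 'a fps)" for k
    by (simp add: fps_compose_power[symmetric] power_mult)
  show ?thesis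
    by (simp add: S_factor_def fps_compose_mult_distrib fps_compose_add_distrib X
        mult.left_commute)
qed

lemma prod_S_factor_Suc:
  fixes w x y z :: "'a::idom"
  shows "(\<Prod>j\<le>Suc m. S_factor w x y z j) =
    S_factor w x y z 0 * ((\<Prod>j\<le>m. S_factor w x y z j) oo fps_X ^ 3)"
  by (subst prod.atMost_Suc_shift)
     (simp add: fps_compose_prod_distrib S_factor_compose_cube)

lemma S_gf_nth_eq_partial:
  assumes "k \<le> m"
  shows "fps_nth (S_gf w x y z) k = fps_nth (\<Prod>j\<le>m. S_factor w x y z j) k"
  using S_partial_nth[OF assms, of w x y z] by (simp add: S_gf_eq)

text \<open>
  The Mahler equation is inherited from the finite products: the coefficient of degree \<open>n\<close> on
  either side only involves coefficients of degree at most \<open>n\<close>, where the infinite product agrees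
  with its partial products.
\<close>

lemma S_gf_mahler:
  fixes w x y z :: "'a::idom"
  shows "S_gf w x y z = S_factor w x y z 0 * (S_gf w x y z oo fps_X ^ 3)"
proof (rule fps_ext)
  fix n
  let ?P = "\<Prod>j\<le>n. S_factor w x y z j"
  have "fps_nth (S_gf w x y z) n = fps_nth (\<Prod>j\<le>Suc n. S_factor w x y z j) n"
    by (rule S_gf_nth_eq_partial) simp
  also have "\<dots> = fps_nth (S_factor w x y z 0 * (?P oo fps_X ^ 3)) n"
    by (simp only: prod_S_factor_Suc)
  also have "\<dots> = fps_nth (S_factor w x y z 0 * (S_gf w x y z oo fps_X ^ 3)) n"
    unfolding fps_mult_nth
    by (intro sum.cong refl)
       (simp add: fps_nth_compose_X_power S_gf_nth_eq_partial[of _ n])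
  finally show "fps_nth (S_gf w x y z) n = \<dots>" .
qed

lemma S_factor_0_expand:
  "S_factor w x y z 0 = 1 + fps_const (w + x + y) * fps_X ^ 1
     + fps_const (w * x + w * y + x * y + z) * fps_X ^ 2
     + fps_const (w * x * y + w * z + x * z) * fps_X ^ 3
     + fps_const (w * x * z) * fps_X ^ 4"
  \<comment> \<open>The exponent 1 is kept so that one rule extracts the coefficients of all shifted terms.\<close>
  by (simp add: S_factor_def algebra_simps power2_eq_square power3_eq_cube power4_eq_xxxx
      flip: fps_const_add fps_const_mult)

lemma S_factor_0_mult_nth:
  "fps_nth (S_factor w x y z 0 * G) n = fps_nth G n
     + (if n < 1 then 0 else (w + x + y) * fps_nth G (n - 1))
     + (if n < 2 then 0 else (w * x + w * y + x * y + z) * fps_nth G (n - 2))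
     + (if n < 3 then 0 else (w * x * y + w * z + x * z) * fps_nth G (n - 3))
     + (if n < 4 then 0 else w * x * z * fps_nth G (n - 4))"
  unfolding S_factor_0_expand distrib_right mult.assoc fps_add_nth
    fps_mult_left_const_nth fps_X_power_mult_nth
  by simp

text \<open>
  Here \<open>c\<close> is the coefficient sequence of \<open>F(q\<^sup>3)\<close>. At most two of the five terms survive, since
  the others have indices that are not divisible by \<open>3\<close>.
\<close>

lemma S_gf_nth_mahler:
  fixes w x y z :: "'a::idom"
  defines "c \<equiv> \<lambda>n. if 3 dvd n then fps_nth (S_gf w x y z) (n div 3) else 0"
  shows "fps_nth (S_gf w x y z) n = c n
     + (if n < 1 then 0 else (w + x + y) * c (n - 1))
     + (if n < 2 then 0 else (w * x + w * y + x * y + z) * c (n - 2))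
     + (if n < 3 then 0 else (w * x * y + w * z + x * z) * c (n - 3))
     + (if n < 4 then 0 else w * x * z * c (n - 4))"
  using S_factor_0_mult_nth[of w x y z "S_gf w x y z oo fps_X ^ 3" n]
  unfolding S_gf_mahler[symmetric] fps_nth_compose_X_power c_def .

text \<open>
  In the next two lemmas the case \<open>m = 0\<close> is where the convention \<open>S(-1) = 0\<close> enters: the terms
  of the Mahler recurrence that would carry \<open>S(m - 1)\<close> are then absent.
\<close>

lemma S_triple:
  fixes w x y z :: "'a::idom"
  assumes "m \<ge> 0"
  shows "S (3 * m) w x y z
    = S m w x y z + (w * x * y + w * z + x * z) * S (m - 1) w x y z"
proof (cases "m = 0")
  case True
  then show ?thesis by (simp add: S_def)
next
  case False
  then obtain l where m: "m = int (Suc l)"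
    using assms by (metis nonneg_int_cases not0_implies_Suc of_nat_0)
  then have nat: "nat (3 * m) = 3 * Suc l" "nat m = Suc l" "nat (m - 1) = l"
    by simp_all
  have "\<not> 3 dvd 3 * Suc l - 1" "\<not> 3 dvd 3 * Suc l - 2"
    "3 * Suc l < 4 \<or> \<not> 3 dvd 3 * Suc l - 4"
    by presburger+
  moreover have "3 * Suc l - 3 = 3 * l" "\<not> 3 * Suc l < 3"
    by simp_all
  ultimately have "fps_nth (S_gf w x y z) (3 * Suc l) = fps_nth (S_gf w x y z) (Suc l)
      + (w * x * y + w * z + x * z) * fps_nth (S_gf w x y z) l"
    by (subst S_gf_nth_mahler) (auto simp del: mult_Suc_right)
  then show ?thesis
    using m nat by (simp add: S_def del: mult_Suc_right)
qed

lemma S_triple_plus_1: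
  fixes w x y z :: "'a::idom"
  assumes "m \<ge> 0"
  shows "S (3 * m + 1) w x y z = (w + x + y) * S m w x y z + w * x * z * S (m - 1) w x y z"
proof (cases "m = 0")
  case True
  then show ?thesis
    using S_gf_nth_mahler[of w x y z 1] by (simp add: S_def)
next
  case False
  then obtain l where m: "m = int (Suc l)"
    using assms by (metis nonneg_int_cases not0_implies_Suc of_nat_0)
  then have nat: "nat (3 * m + 1) = 3 * l + 4" "nat m = Suc l" "nat (m - 1) = l"
    by simp_all
  have "\<not> 3 dvd 3 * l + 4" "\<not> 3 dvd 3 * l + 4 - 2" "\<not> 3 dvd 3 * l + 4 - 3"
    by presburger+
  moreover have "3 * l + 4 - 4 = 3 * l" "3 * l + 4 - 1 = 3 * Suc l"
    by simp_all
  ultimately have "fps_nth (S_gf w x y z) (3 * l + 4) =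
      (w + x + y) * fps_nth (S_gf w x y z) (Suc l) + w * x * z * fps_nth (S_gf w x y z) l"
    by (subst S_gf_nth_mahler) (simp del: mult_Suc_right)
  then show ?thesis
    using m nat by (simp add: S_def)
qed

section \<open>The linear system for Q and R\<close>

lemma half_power_3_index:
  fixes n :: nat
  defines "r \<equiv> (3 ^ n - 1) div 2 :: int"
  shows "r \<ge> 0" "(3 ^ n - 3) div 2 = r - 1"
    "(3 ^ Suc n - 3) div 2 = 3 * r" "(3 ^ Suc n - 1) div 2 = 3 * r + 1"
proof -
  have "odd (3 ^ n :: int)" "(3 ^ n :: int) \<ge> 1"
    by simp_all
  moreover from this(1) obtain k :: int where "3 ^ n = 2 * k + 1"
    by (rule oddE)
  ultimately have k: "3 ^ n = 2 * k + 1" "k \<ge> 0"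
    by simp_all
  then show "r \<ge> 0" "(3 ^ n - 3) div 2 = r - 1"
    "(3 ^ Suc n - 3) div 2 = 3 * r" "(3 ^ Suc n - 1) div 2 = 3 * r + 1"
    by (simp_all add: r_def)
qed

lemma Q_Suc:
  fixes w x y z :: "'a::idom"
  shows "Q (Suc n) w x y z = R n w x y z + (w * x * y + w * z + x * z) * Q n w x y z"
  using S_triple[OF half_power_3_index(1)[of n]]
  unfolding Q_def R_def half_power_3_index(3) half_power_3_index(2)[of n] .

lemma R_Suc:
  fixes w x y z :: "'a::idom"
  shows "R (Suc n) w x y z = (w + x + y) * R n w x y z + w * x * z * Q n w x y z"
  using S_triple_plus_1[OF half_power_3_index(1)[of n]]
  unfolding Q_def R_def half_power_3_index(4) half_power_3_index(2)[of n] .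

lemma Q_0: "Q 0 w x y z = 0"
  by (simp add: Q_def S_def)

lemma R_0: "R 0 w x y z = 1"
  by (simp add: R_def S_def S_gf_eq S_factor_nth_0)

text \<open>
  Cayley--Hamilton for the system above: \<open>W1\<close> is the trace and \<open>W2\<close> the determinant of its matrix.
\<close>

lemma Q_recurrence:
  fixes w x y z :: "'a::idom"
  shows "Q (Suc (Suc n)) w x y z = W1 w x y z * Q (Suc n) w x y z - W2 w x y z * Q n w x y z"
  by (simp add: Q_Suc R_Suc W1_def W2_def algebra_simps power2_eq_square)

section \<open>Chebyshev polynomials\<close>

lemma cheb_U_step:
  fixes v :: "'a::field"
  shows "cheb_U n v = (if n = 0 then 1 else 0)
    + 2 * v * (if n < 1 then 0 else cheb_U (n - 1) v)
    - (if n < 2 then 0 else cheb_U (n - 2) v)"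
proof -
  let ?D = "1 - fps_const (2 * v) * fps_X ^ 1 + fps_X ^ 2"
  \<comment> \<open>Stated for abstract series, as simplification would otherwise rewrite the quotient itself.\<close>
  have "G = 1 + c * (X * G) - Y * G" if "G * (1 - c * X + Y) = 1" for G c X Y :: "'a fps"
    using that by (simp add: algebra_simps)
  moreover have "1 / ?D * ?D = 1"
    by (simp add: fps_divide_unit inverse_mult_eq_1)
  ultimately have "1 / ?D = 1 + fps_const (2 * v) * (fps_X ^ 1 * (1 / ?D)) - fps_X ^ 2 * (1 / ?D)"
    by blast
  \<comment> \<open>A shift by \<open>fps_X ^ k\<close> turns this functional equation into the recurrence.\<close>
  then have "fps_nth (1 / ?D) n =
      fps_nth (1 + fps_const (2 * v) * (fps_X ^ 1 * (1 / ?D)) - fps_X ^ 2 * (1 / ?D)) n"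
    by (rule arg_cong)
  then show ?thesis
    unfolding cheb_U_def fps_sub_nth fps_add_nth fps_mult_left_const_nth
      fps_X_power_mult_nth fps_one_nth unfolding power_one_right .
qed

lemma cheb_U_0: "cheb_U 0 v = 1"
  by (simp add: cheb_U_step[of 0])

lemma cheb_U_1: "cheb_U (Suc 0) v = 2 * v"
  by (simp add: cheb_U_step[of "Suc 0"] cheb_U_0)

lemma cheb_U_Suc_Suc: "cheb_U (Suc (Suc n)) v = 2 * v * cheb_U (Suc n) v - cheb_U n v"
  by (simp add: cheb_U_step[of "Suc (Suc n)"])

text \<open>The numerator \<open>1 - v t\<close> of the generating function of the \<open>T\<^sub>n\<close> yields \<open>T\<^sub>n = U\<^sub>n - v U\<^sub>n\<^sub>-\<^sub>1\<close>.\<close>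

lemma cheb_T_eq_cheb_U:
  "cheb_T n v = cheb_U n v - v * (if n < 1 then 0 else cheb_U (n - 1) v)"
proof -
  let ?D = "1 - fps_const (2 * v) * fps_X + fps_X\<^sup>2"
  have "(1 - fps_const v * fps_X) / ?D = 1 / ?D - fps_const v * (fps_X ^ 1 * (1 / ?D))"
    by (simp add: fps_divide_unit algebra_simps)
  then show ?thesis
    unfolding cheb_T_def cheb_U_def
    by (simp only: fps_sub_nth fps_mult_left_const_nth fps_X_power_mult_nth)
qed

lemma cheb_T_0: "cheb_T 0 v = 1"
  by (simp add: cheb_T_eq_cheb_U cheb_U_0)

lemma cheb_T_Suc: "cheb_T (Suc n) v = cheb_U (Suc n) v - v * cheb_U n v"
  by (simp add: cheb_T_eq_cheb_U)

section \<open>Closed forms\<close>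

text \<open>
  Both sides obey the same second-order recurrence: scaling by \<open>s\<^sup>n\<close> turns the coefficients \<open>2 v\<close>
  and \<open>1\<close> of the recurrence of \<open>U\<^sub>n(v)\<close> into \<open>2 v s = W\<^sub>1\<close> and \<open>s\<^sup>2 = W\<^sub>2\<close>.
\<close>

lemma Q_eq_cheb_U:
  fixes w x y z s :: "'a::field_char_0"
  assumes "s \<noteq> 0" "s\<^sup>2 = W2 w x y z"
  shows "Q (Suc n) w x y z = s ^ n * cheb_U n (W1 w x y z / (2 * s))"
proof (induction n rule: induct_nat_012)
  case 0
  show ?case by (simp add: Q_Suc Q_0 R_0 cheb_U_0)
next
  case 1
  show ?case using assms(1) by (simp add: Q_recurrence[of 0] Q_Suc[of 0] Q_0 R_0 cheb_U_1)
next
  case (ge2 n)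
  let ?v = "W1 w x y z / (2 * s)"
  have "s ^ Suc (Suc n) * cheb_U (Suc (Suc n)) ?v =
      (2 * ?v * s) * (s ^ Suc n * cheb_U (Suc n) ?v) - s\<^sup>2 * (s ^ n * cheb_U n ?v)"
    by (simp add: cheb_U_Suc_Suc algebra_simps power2_eq_square)
  also have "2 * ?v * s = W1 w x y z"
    using assms(1) by simp
  finally show ?case
    using Q_recurrence[of "Suc n" w x y z] by (simp only: ge2 assms(2))
qed

theorem proposition3p5:
  fixes w x y z s :: "'a::field_char_0"
  assumes "W2 w x y z \<noteq> 0"
    and "s\<^sup>2 = W2 w x y z"
  shows "\<forall>n. Q (n + 1) w x y z = s ^ n * cheb_U n (W1 w x y z / (2 * s)) \<and>
             R n w x y z = s ^ n * cheb_T n (W1 w x y z / (2 * s))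
               + (w + x + y - (w * x * y + w * z + x * z)) / 2 * Q n w x y z"
proof (intro allI conjI)
  fix n
  let ?v = "W1 w x y z / (2 * s)"
  have s: "s \<noteq> 0"
    using assms by auto
  note Q_U = Q_eq_cheb_U[OF s assms(2)]
  show "Q (n + 1) w x y z = s ^ n * cheb_U n ?v"
    using Q_U by simp
  show "R n w x y z = s ^ n * cheb_T n ?v
               + (w + x + y - (w * x * y + w * z + x * z)) / 2 * Q n w x y z"
  proof (cases n)
    case 0
    then show ?thesis by (simp add: R_0 Q_0 cheb_T_0)
  next
    case (Suc m)
    have "s ^ n * cheb_T n ?v = s ^ n * cheb_U n ?v - (s * ?v) * (s ^ m * cheb_U m ?v)"
      by (simp add: Suc cheb_T_Suc algebra_simps)
    also have "\<dots> = Q (Suc n) w x y z - W1 w x y z / 2 * Q n w x y z"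
      using s by (simp add: Suc Q_U)
    \<comment> \<open>Here \<open>R\<^sub>n = Q\<^sub>n\<^sub>+\<^sub>1 - a\<^sub>3 Q\<^sub>n\<close>, and \<open>a\<^sub>3 - (a\<^sub>1 + a\<^sub>3) / 2 = - (a\<^sub>1 - a\<^sub>3) / 2\<close>.\<close>
    also have "\<dots> = R n w x y z
        - (w + x + y - (w * x * y + w * z + x * z)) / 2 * Q n w x y z"
      by (simp add: Q_Suc W1_def field_simps)
    finally show ?thesis by simp
  qed
qed

end
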